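(* In the variable-assignment setting, suppose there is a function $\mu:\mathcal B\to[0,\infty)$ such that $$\forall B\in\mathcal B:\qquad \mu(B)\ \ge\ P_\Omega(B)\sum_{\substack{Y\subseteq \mathcal B\\ Y \text{ orderable to } B}}\ \prod_{B'\in Y}\mu(B').$$ Then the MT algorithm terminates with probability 1, and for every $B\in\mathcal B$ the expected number of times $B$ is resampled is at most $\mu(B)$.
   Context: Variable-assignment setting: there are variables $X_1,\dots,X_n$, each taking values in a finite set; $\Omega$ is the product distribution in which the variables are independent with $P_\Omega(X_i=j)=p_{ij}$. A bad-event is atomic: a finite set $B$ of pairs $(i,j)$ with distinct first coordinates, identified with the event $\bigwedge_{(i,j)\in B}(X_i=j)$. $\mathcal B$ is a finite set of bad-events, $m=|\mathcal B|$. For pairs, $(i,j)\sim(i',j')$ iff $i=i'$ and $j\neq j'$. For a pair $z$ and a set of pairs $B$, $z\sim B$ iff there is $z'\in B$ with $z\sim z'$. For a variable $i$, $i\sim B$ means $(i,j)\in B$ for some $j$. Orderable sets: given an event $E$ (a set of pairs), a set $Y\subseteq\mathcal B$ is orderable to $E$ if either (O1) $Y=\{E\}$, or (O2) $Y$ can be enumerated as $Y=\{B_1,\dots,B_s\}$ (distinct elements) so that for each $i=1,\dots,s$ there is $z_i\in E$ with $z_i\sim B_i$ and $z_i\not\sim B_1,\dots,z_i\not\sim B_{i-1}$. (In particular $\emptyset$ is orderable to $E$.) MT algorithm: (1) draw all variables independently from $\Omega$; (2) while some bad-event in $\mathcal B$ is true, choose a true bad-event $B$ and resample every variable $X_i$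 with $i\sim B$ independently from its $\Omega$-distribution. The choice of which true bad-event to resample is arbitrary, but may depend only on the current and past state of the algorithm, not on future random draws. *)

theory Defs
  imports "HOL-Probability.Probability"
begin

text \<open>Variables are indexed by natural numbers i < n; values have type 'v.
  An assignment is a function nat => 'v; a (atomic) bad-event is a set of
  pairs (i, j), meaning the conjunction of X_i = j.\<close>

type_synonym 'v asg = "nat \<Rightarrow> 'v"
type_synonym 'v bev = "(nat \<times> 'v) set"

definition holds :: "'v asg \<Rightarrow> 'v bev \<Rightarrow> bool" where
  "holds a B \<longleftrightarrow> (\<forall>(i, j) \<in> B. a i = j)"

definition sim_pair :: "(nat \<times> 'v) \<Rightarrow> (nat \<times> 'v) \<Rightarrow> bool" where
  "sim_pair z z' \<longleftrightarrow> fst z = fst z' \<and> snd z \<noteq> snd z'"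

definition sim_set :: "(nat \<times> 'v) \<Rightarrow> 'v bev \<Rightarrow> bool" where
  "sim_set z B \<longleftrightarrow> (\<exists>z' \<in> B. sim_pair z z')"

definition orderable :: "'v bev set \<Rightarrow> 'v bev \<Rightarrow> bool" where
  "orderable Y E \<longleftrightarrow>
     Y = {E} \<or>
     (\<exists>bs. distinct bs \<and> set bs = Y \<and>
        (\<forall>k < length bs. \<exists>z \<in> E. sim_set z (bs ! k) \<and> (\<forall>l < k. \<not> sim_set z (bs ! l))))"

definition Omega :: "nat \<Rightarrow> (nat \<Rightarrow> 'v pmf) \<Rightarrow> 'v asg pmf" where
  "Omega n p = Pi_pmf {..<n} undefined p"

definition PO :: "nat \<Rightarrow> (nat \<Rightarrow> 'v pmf) \<Rightarrow> 'v bev \<Rightarrow> real" where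
  "PO n p B = measure_pmf.prob (Omega n p) {a. holds a B}"

definition resample :: "(nat \<Rightarrow> 'v pmf) \<Rightarrow> 'v asg \<Rightarrow> 'v bev \<Rightarrow> 'v asg pmf" where
  "resample p a B =
     map_pmf (\<lambda>g i. if i \<in> fst ` B then g i else a i) (Pi_pmf (fst ` B) undefined p)"

definition some_true :: "'v bev set \<Rightarrow> 'v asg \<Rightarrow> bool" where
  "some_true \<B> a \<longleftrightarrow> (\<exists>B \<in> \<B>. holds a B)"

text \<open>A selection rule: a function of the history of states (oldest first,
  the last entry is the current state) choosing a true bad-event whenever one exists.\<close>
definition valid_rule :: "'v bev set \<Rightarrow> ('v asg list \<Rightarrow> 'v bev) \<Rightarrow> bool" where
  "valid_rule \<B> sel \<longleftrightarrow>
     (\<forall>h. h \<noteq> [] \<and> some_true \<B> (last h) \<longrightarrow> sel h \<in> \<B> \<and> holds (last h) (sel h))"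

definition mt_step :: "'v bev set \<Rightarrow> (nat \<Rightarrow> 'v pmf) \<Rightarrow> ('v asg list \<Rightarrow> 'v bev)
                       \<Rightarrow> 'v asg list \<Rightarrow> 'v asg list pmf" where
  "mt_step \<B> p sel h =
     (if some_true \<B> (last h)
      then map_pmf (\<lambda>a'. h @ [a']) (resample p (last h) (sel h))
      else return_pmf h)"

primrec mt_hist :: "'v bev set \<Rightarrow> nat \<Rightarrow> (nat \<Rightarrow> 'v pmf) \<Rightarrow> ('v asg list \<Rightarrow> 'v bev)
                    \<Rightarrow> nat \<Rightarrow> 'v asg list pmf" where
  "mt_hist \<B> n p sel 0 = map_pmf (\<lambda>a. [a]) (Omega n p)"
| "mt_hist \<B> n p sel (Suc t) = bind_pmf (mt_hist \<B> n p sel t) (mt_step \<B> p sel)"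

text \<open>Number of times B has been resampled along a history: every transition
  h!k -> h!(k+1) is a resampling of the event chosen at the prefix take (k+1) h.\<close>
definition resample_count :: "('v asg list \<Rightarrow> 'v bev) \<Rightarrow> 'v bev \<Rightarrow> 'v asg list \<Rightarrow> nat" where
  "resample_count sel B h = card {k. Suc k < length h \<and> sel (take (Suc k) h) = B}"

end

theory Submission
  imports Defs
begin

text \<open>A backwards reading of the execution log grows a witness tree: a resampled event \<open>B\<close> is attached
  as a child of a deepest node at which the set of child labels stays orderable, and is discarded if
  there is no such node. The frontier of a tree \<open>\<tau>\<close> collects, for every variable, the pairs at the deepest
  nodes using that variable. The function
  \<open>G \<tau> a = [a satisfies the frontier of \<tau>] * (product of P(B) over all nodes of \<tau>) / P(frontier of \<tau>)\<close>
  bounds the expected number of future moments at which the tree produced is \<open>\<tau>\<close>, given the current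
  state \<open>a\<close>. Indeed, if \<open>a'\<close> arises from \<open>a\<close> by resampling \<open>B\<close>, then the expectation of \<open>G \<tau> a'\<close> is at most
  \<open>G (attach B \<tau>) a\<close>, and \<open>attach B\<close> is injective on trees. So the number of resamplings of \<open>B\<close> so far
  plus the sum of \<open>G \<tau>\<close> over trees with root \<open>B\<close>, whose allowed depth decreases by one per step, is a
  supermartingale. Averaging over the initial distribution turns \<open>G \<tau>\<close> into the product weight of \<open>\<tau>\<close>, and the
  hypothesis on \<open>\<mu>\<close> bounds the total weight of all trees with root \<open>B\<close> by \<open>\<mu> B\<close>.\<close>

text \<open>A tree is a set of paths: a node is the list of labels from itself (head) to the root (last).
  Nothing is lost, because in an orderable set siblings have distinct labels.\<close>

subsection \<open>Witness trees\<close>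

definition children :: "'v bev list set \<Rightarrow> 'v bev list \<Rightarrow> 'v bev set" where
  "children \<tau> u = {B. B # u \<in> \<tau>}"

definition witness_tree :: "'v bev set \<Rightarrow> 'v bev \<Rightarrow> 'v bev list set \<Rightarrow> bool" where
  "witness_tree \<B> E \<tau> \<longleftrightarrow>
     finite \<tau> \<and> [E] \<in> \<tau> \<and> (\<forall>u \<in> \<tau>. u \<noteq> [] \<and> last u = E) \<and>
     (\<forall>B u. B # u \<in> \<tau> \<and> u \<noteq> [] \<longrightarrow> u \<in> \<tau>) \<and>
     (\<forall>u \<in> \<tau>. children \<tau> u \<subseteq> \<B> \<and> orderable (children \<tau> u) (hd u))"

definition witness_trees :: "'v bev set \<Rightarrow> nat \<Rightarrow> 'v bev \<Rightarrow> 'v bev list set set" where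
  "witness_trees \<B> T E = {\<tau>. witness_tree \<B> E \<tau> \<and> (\<forall>u \<in> \<tau>. length u \<le> T)}"

text \<open>Both ways of enlarging an orderable set of siblings occur here: a leaf may receive a
  copy of its own label (O1), after which it accepts no further child; otherwise \<open>B\<close>
  must be able to come last in an enumeration (O2).\<close>

definition attachable :: "'v bev \<Rightarrow> 'v bev list set \<Rightarrow> 'v bev list \<Rightarrow> bool" where
  "attachable B \<tau> u \<longleftrightarrow> u \<in> \<tau> \<and>
     (hd u = B \<and> children \<tau> u = {} \<or>
      hd u \<notin> children \<tau> u \<and>
      (\<exists>z \<in> hd u. sim_set z B \<and> (\<forall>B' \<in> children \<tau> u. \<not> sim_set z B')))"

text \<open>Several attachable nodes may be deepest; \<open>arg_max\<close> picks one of them, and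
  the later arguments use only that its length is maximal.\<close>

definition attach :: "'v bev \<Rightarrow> 'v bev list set \<Rightarrow> 'v bev list set" where
  "attach B \<tau> =
     (if \<exists>u. attachable B \<tau> u then insert (B # arg_max length (attachable B \<tau>)) \<tau> else \<tau>)"

definition frontier :: "'v bev list set \<Rightarrow> 'v bev" where
  "frontier \<tau> =
     {(i, j). \<exists>u \<in> \<tau>. (i, j) \<in> hd u \<and> (\<forall>v \<in> \<tau>. i \<in> fst ` hd v \<longrightarrow> length v \<le> length u)}"

section \<open>Attaching an event to a witness tree\<close>

lemma attach_cases:
  assumes "finite \<tau>"
  obtains (skip) "\<And>u. \<not> attachable B \<tau> u" "attach B \<tau> = \<tau>"
  | (add) u where "attachable B \<tau> u" "\<And>v. attachable B \<tau> v \<Longrightarrow> length v \<le> length u"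
      "attach B \<tau> = insert (B # u) \<tau>"
proof (cases "\<exists>u. attachable B \<tau> u")
  case True
  then obtain u where u: "attachable B \<tau> u" ..
  have "\<exists>b. \<forall>v \<in> \<tau>. length v < b"
    using finite_imageI[OF assms, of length] by (auto simp: finite_nat_set_iff_bounded)
  then obtain b where "\<forall>v. attachable B \<tau> v \<longrightarrow> length v < b"
    unfolding attachable_def by blast
  from arg_max_nat_lemma[OF u this] True show ?thesis
    by (intro add[of "arg_max length (attachable B \<tau>)"]) (auto simp: attach_def)
qed (auto simp: attach_def intro: skip)

lemma attachable_not_child: "attachable B \<tau> u \<Longrightarrow> B # u \<notin> \<tau>"
  by (auto simp: attachable_def children_def)

lemma attachable_leaf: "u \<in> \<tau> \<Longrightarrow> hd u = B \<Longrightarrow> children \<tau> u = {} \<Longrightarrow> attachable B \<tau> u"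
  by (auto simp: attachable_def)

text \<open>\<open>B\<close> goes to the end of an enumeration of the present children, and the
  conflicting pair from \<open>attachable\<close> serves as its witness.\<close>

lemma orderable_insert_child:
  assumes "attachable B \<tau> u" "orderable (children \<tau> u) (hd u)"
  shows "orderable (insert B (children \<tau> u)) (hd u)"
proof (cases "hd u = B \<and> children \<tau> u = {}")
  case True
  then show ?thesis by (auto simp: orderable_def)
next
  case False
  then obtain z where z: "hd u \<notin> children \<tau> u" "z \<in> hd u" "sim_set z B"
      "\<forall>B' \<in> children \<tau> u. \<not> sim_set z B'"
    using assms(1) by (auto simp: attachable_def)
  \<comment> \<open>As \<open>hd u\<close> is not a child, the present children are not the
    singleton of (O1), so an enumeration as in (O2) exists.\<close>
  then obtain bs where bs: "distinct bs" "set bs = children \<tau> u"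
      "\<forall>k < length bs. \<exists>z \<in> hd u. sim_set z (bs ! k) \<and> (\<forall>l < k. \<not> sim_set z (bs ! l))"
    using assms(2) by (auto simp: orderable_def)
  have "B \<notin> set bs" using z bs(2) by auto
  moreover have "\<exists>z \<in> hd u. sim_set z ((bs @ [B]) ! k) \<and> (\<forall>l < k. \<not> sim_set z ((bs @ [B]) ! l))"
    if "k < length (bs @ [B])" for k
  proof (cases "k < length bs")
    case True
    then show ?thesis using bs(3) by (auto simp: nth_append)
  next
    case False
    then have "k = length bs" using that by simp
    moreover have "\<not> sim_set z (bs ! l)" if "l < length bs" for l
      using that z(4) bs(2) nth_mem by blast
    ultimately show ?thesis using z by (auto simp: nth_append)
  qed
  ultimately show ?thesis
    using bs unfolding orderable_def by (intro disjI2 exI[of _ "bs @ [B]"]) auto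
qed

lemma witness_treeD:
  assumes "witness_tree \<B> E \<tau>"
  shows "finite \<tau>" "[E] \<in> \<tau>"
    and "\<And>u. u \<in> \<tau> \<Longrightarrow> u \<noteq> []" "\<And>u. u \<in> \<tau> \<Longrightarrow> last u = E"
    and "\<And>B u. B # u \<in> \<tau> \<Longrightarrow> u \<noteq> [] \<Longrightarrow> u \<in> \<tau>"
    and "\<And>u. u \<in> \<tau> \<Longrightarrow> children \<tau> u \<subseteq> \<B>"
    and "\<And>u. u \<in> \<tau> \<Longrightarrow> orderable (children \<tau> u) (hd u)"
  using assms unfolding witness_tree_def by blast+

text \<open>A child of the new node lying in \<tau> would have forced its parent, the new node
  itself, into \<tau>.\<close>

lemma new_node_leaf:
  assumes "witness_tree \<B> E \<tau>" "B # u \<notin> \<tau>"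
  shows "children (insert (B # u) \<tau>) (B # u) = {}"
  using assms(2) witness_treeD(5)[OF assms(1), of _ "B # u"] by (auto simp: children_def)

lemma witness_tree_attach:
  assumes \<tau>: "witness_tree \<B> E \<tau>" and B: "B \<in> \<B>"
  shows "witness_tree \<B> E (attach B \<tau>)"
proof -
  have fin: "finite \<tau>" using witness_treeD[OF \<tau>] by blast
  then show ?thesis
  proof (cases rule: attach_cases[where B = B])
    case skip
    then show ?thesis using \<tau> by simp
  next
    case (add u)
    have u: "u \<in> \<tau>" "u \<noteq> []" "last u = E"
      using add(1) witness_treeD[OF \<tau>] by (simp_all add: attachable_def)
    have new: "B # u \<notin> \<tau>" by (rule attachable_not_child[OF add(1)])
    have ch_u: "children (insert (B # u) \<tau>) u = insert B (children \<tau> u)"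
      by (auto simp: children_def)
    have ch_new: "children (insert (B # u) \<tau>) (B # u) = {}"
      by (rule new_node_leaf[OF \<tau> new])
    have ch: "children (insert (B # u) \<tau>) v = children \<tau> v" if "v \<noteq> u" for v
      using that by (auto simp: children_def)
    have "children (insert (B # u) \<tau>) v \<subseteq> \<B> \<and> orderable (children (insert (B # u) \<tau>) v) (hd v)"
      if v: "v \<in> insert (B # u) \<tau>" for v
    proof -
      consider "v = u" | "v = B # u" | "v \<noteq> u" "v \<in> \<tau>" using v by auto
      then show ?thesis
      proof cases
        case 1
        have "orderable (children \<tau> u) (hd u)" "children \<tau> u \<subseteq> \<B>"
          using witness_treeD[OF \<tau>] u(1) by simp_all
        then show ?thesis
          using orderable_insert_child[OF add(1)] B ch_u 1 by auto
      next
        case 2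
        have "orderable {} B" unfolding orderable_def by auto
        then show ?thesis using ch_new 2 by auto
      next
        case 3
        then show ?thesis using ch witness_treeD(6,7)[OF \<tau>] by simp
      qed
    qed
    moreover have "v \<noteq> [] \<and> last v = E" if "v \<in> insert (B # u) \<tau>" for v
      using that u witness_treeD(3,4)[OF \<tau>] by auto
    moreover have "B' # v \<in> insert (B # u) \<tau> \<and> v \<noteq> [] \<longrightarrow> v \<in> insert (B # u) \<tau>" for B' v
      using u(1) witness_treeD(5)[OF \<tau>] by auto
    ultimately show ?thesis
      using fin witness_treeD(2)[OF \<tau>] unfolding add(3) witness_tree_def
      by (intro conjI allI ballI) simp_all
  qed
qed

lemma attach_in_witness_trees:
  assumes \<tau>: "\<tau> \<in> witness_trees \<B> T E" and B: "B \<in> \<B>"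
  shows "attach B \<tau> \<in> witness_trees \<B> (Suc T) E"
proof -
  have wt: "witness_tree \<B> E \<tau>" and len: "\<And>u. u \<in> \<tau> \<Longrightarrow> length u \<le> T"
    using \<tau> by (auto simp: witness_trees_def)
  then have "finite \<tau>" by (simp add: witness_tree_def)
  then have "\<forall>u \<in> attach B \<tau>. length u \<le> Suc T"
  proof (cases rule: attach_cases[where B = B])
    case (add u)
    then have "length u \<le> T" by (auto simp: attachable_def intro: len)
    then show ?thesis using len add(3) by (auto intro: le_SucI)
  qed (auto intro: len le_SucI)
  with witness_tree_attach[OF wt B] show ?thesis by (simp add: witness_trees_def)
qed

text \<open>The attached node is the strictly longest leaf labelled \<open>B\<close>, since any other such leaf would
  itself have been attachable; so it can be recovered from the result.\<close>

lemma inj_on_attach: "inj_on (attach B) {\<tau>. witness_tree \<B> E \<tau>}"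
proof (rule inj_onI)
  have longest: "length v < length (B # u)"
    if "witness_tree \<B> E \<tau>" "\<And>v. attachable B \<tau> v \<Longrightarrow> length v \<le> length u" "v \<noteq> B # u"
      "v \<in> insert (B # u) \<tau>" "hd v = B" "children (insert (B # u) \<tau>) v = {}" for \<tau> u v
  proof -
    have "children \<tau> v = {}" using that(6) by (auto simp: children_def)
    moreover have "v \<in> \<tau>" using that by auto
    ultimately have "length v \<le> length u" using attachable_leaf that(2,5) by blast
    then show ?thesis by simp
  qed
  note leaf = new_node_leaf[OF _ attachable_not_child]
  fix \<tau>1 \<tau>2
  assume "\<tau>1 \<in> {\<tau>. witness_tree \<B> E \<tau>}" "\<tau>2 \<in> {\<tau>. witness_tree \<B> E \<tau>}"
    and eq: "attach B \<tau>1 = attach B \<tau>2"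
  then have wt: "witness_tree \<B> E \<tau>1" "witness_tree \<B> E \<tau>2" by auto
  then have fin: "finite \<tau>1" "finite \<tau>2" using witness_treeD(1) by blast+
  from fin(1) show "\<tau>1 = \<tau>2"
  proof (cases rule: attach_cases[where B = B])
    case skip1: skip
    from fin(2) show ?thesis
    proof (cases rule: attach_cases[where B = B])
      case skip
      then show ?thesis using eq skip1 by simp
    next
      case (add u)
      \<comment> \<open>The node added on one side is a leaf labelled \<open>B\<close> of the tree
        on the other side, so \<open>B\<close> could not have been discarded there.\<close>
      then have "\<tau>1 = insert (B # u) \<tau>2" using eq skip1 by simp
      then have "attachable B \<tau>1 (B # u)"
        using leaf[OF wt(2) add(1)] by (intro attachable_leaf) auto
      then show ?thesis using skip1 by blast
    qed
  next
    case add1: (add u1)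
    from fin(2) show ?thesis
    proof (cases rule: attach_cases[where B = B])
      case skip
      then have "\<tau>2 = insert (B # u1) \<tau>1" using eq add1 by simp
      then have "attachable B \<tau>2 (B # u1)"
        using leaf[OF wt(1) add1(1)] by (intro attachable_leaf) auto
      then show ?thesis using skip by blast
    next
      case (add u2)
      have ins: "insert (B # u1) \<tau>1 = insert (B # u2) \<tau>2" using eq add1 add by simp
      \<comment> \<open>Two different new nodes would both be \<open>B\<close>-leaves of the common
        tree, each strictly shorter than the other.\<close>
      have "u1 = u2"
      proof (rule ccontr)
        assume ne: "u1 \<noteq> u2"
        have "length (B # u2) < length (B # u1)"
          using longest[OF wt(1) add1(2), of "B # u2"] leaf[OF wt(2) add(1)] ins ne by auto
        moreover have "length (B # u1) < length (B # u2)"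
          using longest[OF wt(2) add(2), of "B # u1"] leaf[OF wt(1) add1(1)] ins ne by auto
        ultimately show False by simp
      qed
      then show ?thesis
        using ins attachable_not_child[OF add(1)] attachable_not_child[OF add1(1)]
          insert_ident[of "B # u1" \<tau>1 \<tau>2] by simp
    qed
  qed
qed

text \<open>This keeps the tree started by a resampling of \<open>B\<close> apart from all trees
  obtained by extension. A discard is impossible because the single node \<open>[B]\<close> is a
  leaf labelled \<open>B\<close>; an addition would need the empty path as parent.\<close>

lemma attach_neq_singleton:
  assumes "witness_tree \<B> E \<tau>"
  shows "attach B \<tau> \<noteq> {[B]}"
proof
  assume eq: "attach B \<tau> = {[B]}"
  have fin: "finite \<tau>" and root: "[E] \<in> \<tau>" using witness_treeD(1,2)[OF assms] by simp_all
  from fin show False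
  proof (cases rule: attach_cases[where B = B])
    case skip
    then have "attachable B \<tau> [B]"
      using eq by (intro attachable_leaf) (auto simp: children_def)
    then show False using skip by blast
  next
    case (add u)
    have "u \<in> \<tau>" using add by (auto simp: attachable_def)
    moreover have "u = []" using add(3) eq by auto
    ultimately show False using witness_treeD(3)[OF assms] by blast
  qed
qed

text \<open>Children of \<open>u\<close> are longer than \<open>u\<close>, so none of them uses the
  variable \<open>i\<close>. Hence \<open>(i, j)\<close> conflicts with \<open>B\<close> but with no
  present child, and \<open>hd u\<close>, which uses \<open>i\<close>, is not among the
  children.\<close>

lemma attachable_if_conflict:
  assumes "u \<in> \<tau>" "(i, j) \<in> hd u" "\<forall>v \<in> \<tau>. i \<in> fst ` hd v \<longrightarrow> length v \<le> length u"
    and "(i, j') \<in> B" "j \<noteq> j'"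
  shows "attachable B \<tau> u"
proof -
  have *: "i \<notin> fst ` B'" if "B' \<in> children \<tau> u" for B'
    using assms(3) that by (force simp: children_def)
  have "hd u \<notin> children \<tau> u" using *[of "hd u"] assms(2) by force
  moreover have "sim_set (i, j) B" using assms(4,5) by (force simp: sim_set_def sim_pair_def)
  moreover have "\<forall>B' \<in> children \<tau> u. \<not> sim_set (i, j) B'"
    using * by (force simp: sim_set_def sim_pair_def)
  ultimately show ?thesis using assms(1,2) by (auto simp: attachable_def)
qed

section \<open>The frontier under attachment\<close>

lemma frontier_skip:
  assumes "\<And>u. \<not> attachable B \<tau> u" "(i, j) \<in> frontier \<tau>" "i \<in> fst ` B"
  shows "(i, j) \<in> B"
proof -
  obtain u where "u \<in> \<tau>" "(i, j) \<in> hd u" "\<forall>v \<in> \<tau>. i \<in> fst ` hd v \<longrightarrow> length v \<le> length u"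
    using assms(2) by (auto simp: frontier_def)
  moreover obtain j' where "(i, j') \<in> B" using assms(3) by force
  ultimately show ?thesis using attachable_if_conflict assms(1) by metis
qed

lemma frontier_exists:
  assumes "finite \<tau>" "u \<in> \<tau>" "i \<in> fst ` hd u"
  obtains j where "(i, j) \<in> frontier \<tau>"
proof -
  let ?S = "{v \<in> \<tau>. i \<in> fst ` hd v}"
  have "finite ?S" "?S \<noteq> {}" using assms by auto
  then have "Max (length ` ?S) \<in> length ` ?S" "\<forall>w \<in> ?S. length w \<le> Max (length ` ?S)"
    using Max_in[of "length ` ?S"] Max_ge[of "length ` ?S"] by blast+
  then obtain v where v: "v \<in> \<tau>" "i \<in> fst ` hd v" "\<forall>w \<in> ?S. length w \<le> length v"
    by fastforce
  from v(2) obtain j where "(i, j) \<in> hd v" by force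
  moreover have "\<forall>w \<in> \<tau>. i \<in> fst ` hd w \<longrightarrow> length w \<le> length v" using v(3) by simp
  ultimately have "(i, j) \<in> frontier \<tau>" using v(1) unfolding frontier_def by (simp, blast)
  then show ?thesis by (rule that)
qed

text \<open>If an old node were deepest for a variable of \<open>B\<close> with another value, it
  would be attachable and so shorter than the new node, which uses the same variable. Thus
  \<open>B\<close> overrides the frontier at its own variables, and elsewhere nothing
  changes.\<close>

lemma frontier_add:
  assumes fin: "finite \<tau>" and inj: "inj_on fst B"
    and max: "\<And>v. attachable B \<tau> v \<Longrightarrow> length v \<le> length u"
  shows "frontier (insert (B # u) \<tau>) = B \<union> {(i, j) \<in> frontier \<tau>. i \<notin> fst ` B}"
proof -
  have sub: "(i, j) \<in> B" if fr: "(i, j) \<in> frontier (insert (B # u) \<tau>)" and i: "i \<in> fst ` B" for i j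
  proof (rule ccontr)
    assume notin: "(i, j) \<notin> B"
    obtain v where "v \<in> insert (B # u) \<tau>" and v: "(i, j) \<in> hd v"
        "\<forall>w \<in> insert (B # u) \<tau>. i \<in> fst ` hd w \<longrightarrow> length w \<le> length v"
      using fr unfolding frontier_def by blast
    then have "v \<in> \<tau>" using notin by auto
    obtain j' where "(i, j') \<in> B" using i by force
    moreover have "j \<noteq> j'" using calculation notin by auto
    ultimately have "attachable B \<tau> v" using v \<open>v \<in> \<tau>\<close> attachable_if_conflict[of v \<tau> i j j'] by simp
    then have "length v \<le> length u" by (rule max)
    moreover have "length (B # u) \<le> length v" using v(2) i by simp
    ultimately show False by simp
  qed
  have sup: "(i, j) \<in> frontier (insert (B # u) \<tau>)" if "(i, j) \<in> B" for i j
  proof -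
    have i: "i \<in> fst ` B" using that by force
    \<comment> \<open>Some pair over \<open>i\<close> lies in the frontier, and by
      \<open>sub\<close> it lies in \<open>B\<close>; injectivity of \<open>fst\<close> on
      \<open>B\<close> then identifies it with \<open>(i, j)\<close>.\<close>
    obtain j' where j': "(i, j') \<in> frontier (insert (B # u) \<tau>)"
      using frontier_exists[of "insert (B # u) \<tau>" "B # u" i] fin i
      by (metis finite_insert insertI1 list.sel(1))
    with sub i have "(i, j') \<in> B" by blast
    with that have "j' = j" using inj_onD[OF inj, of "(i, j')" "(i, j)"] by simp
    with j' show ?thesis by simp
  qed
  have "(i, j) \<in> frontier (insert (B # u) \<tau>) \<longleftrightarrow> (i, j) \<in> frontier \<tau>" if "i \<notin> fst ` B" for i j
  proof -
    have "(i, j) \<notin> B" using that by force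
    with that show ?thesis by (simp add: frontier_def)
  qed
  note off = this
  have "x \<in> frontier (insert (B # u) \<tau>) \<longleftrightarrow> x \<in> B \<union> {(i, j) \<in> frontier \<tau>. i \<notin> fst ` B}" for x
  proof (cases x)
    case (Pair i j)
    have "(i, j) \<in> B \<Longrightarrow> i \<in> fst ` B" by force
    then show ?thesis using sub[of i j] sup[of i j] off[of i j] unfolding Pair by blast
  qed
  then show ?thesis by blast
qed

lemma frontier_singleton: "frontier {[B]} = B"
  by (auto simp: frontier_def)

section \<open>Labels of a tree and finiteness at bounded depth\<close>

lemma witness_tree_labels:
  assumes "witness_tree \<B> E \<tau>" "E \<in> \<B>" "u \<in> \<tau>"
  shows "set u \<subseteq> \<B>"
  using assms(3)
proof (induction u)
  case (Cons B u)
  show ?case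
  proof (cases "u = []")
    case True
    then show ?thesis using assms(2) Cons.prems witness_treeD(4)[OF assms(1)] by force
  next
    case False
    then have "u \<in> \<tau>" using Cons.prems witness_treeD(5)[OF assms(1)] by blast
    moreover have "B \<in> children \<tau> u" using Cons.prems by (simp add: children_def)
    ultimately show ?thesis using Cons.IH witness_treeD(6)[OF assms(1)] by auto
  qed
qed simp

lemma finite_witness_trees:
  assumes "finite \<B>" "E \<in> \<B>"
  shows "finite (witness_trees \<B> T E)"
proof (rule finite_subset)
  show "witness_trees \<B> T E \<subseteq> Pow {u. set u \<subseteq> \<B> \<and> length u \<le> T}"
    using witness_tree_labels assms(2) unfolding witness_trees_def by blast
  show "finite (Pow {u. set u \<subseteq> \<B> \<and> length u \<le> T})"
    using finite_lists_length_le[OF assms(1)] by simp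
qed

subsection \<open>Total weight of witness trees\<close>

definition tree_weight :: "('v bev \<Rightarrow> real) \<Rightarrow> 'v bev list set \<Rightarrow> real" where
  "tree_weight P \<tau> = (\<Prod>u \<in> \<tau>. P (hd u))"

text \<open>Paths list the root last, so passing to the subtree at a child strips the final entry
  \<open>E\<close>.\<close>

definition subtree :: "'v bev \<Rightarrow> 'v bev \<Rightarrow> 'v bev list set \<Rightarrow> 'v bev list set" where
  "subtree E B \<tau> = {u. u \<noteq> [] \<and> last u = B \<and> u @ [E] \<in> \<tau>}"

lemma witness_tree_ancestor:
  assumes \<tau>: "witness_tree \<B> E \<tau>"
  shows "u @ [E] \<in> \<tau> \<Longrightarrow> u \<noteq> [] \<Longrightarrow> last u \<in> children \<tau> [E]"
proof (induction u)
  case (Cons B u)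
  show ?case
  proof (cases "u = []")
    case True
    then show ?thesis using Cons.prems by (simp add: children_def)
  next
    case False
    then have "u @ [E] \<in> \<tau>" using Cons.prems witness_treeD(5)[OF \<tau>, of B "u @ [E]"] by simp
    then show ?thesis using Cons.IH False by simp
  qed
qed simp

lemma children_subtree:
  assumes "u \<noteq> []" "last u = B"
  shows "children (subtree E B \<tau>) u = children \<tau> (u @ [E])"
  using assms by (auto simp: children_def subtree_def)

lemma witness_tree_subtree:
  assumes \<tau>: "witness_tree \<B> E \<tau>" and B: "B \<in> children \<tau> [E]"
  shows "witness_tree \<B> B (subtree E B \<tau>)"
  unfolding witness_tree_def
proof (intro conjI allI ballI impI)
  have "(\<lambda>u. u @ [E]) ` subtree E B \<tau> \<subseteq> \<tau>" by (auto simp: subtree_def)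
  then have "finite ((\<lambda>u. u @ [E]) ` subtree E B \<tau>)"
    using witness_treeD(1)[OF \<tau>] by (rule finite_subset)
  then show "finite (subtree E B \<tau>)"
    by (rule finite_imageD) (simp add: inj_on_def)
  show "[B] \<in> subtree E B \<tau>" using B by (simp add: subtree_def children_def)
next
  fix u assume u: "u \<in> subtree E B \<tau>"
  then show ne: "u \<noteq> []" and last: "last u = B" by (auto simp: subtree_def)
  have u': "u @ [E] \<in> \<tau>" using u by (simp add: subtree_def)
  show "children (subtree E B \<tau>) u \<subseteq> \<B>"
    using witness_treeD(6)[OF \<tau> u'] children_subtree[OF ne last] by simp
  show "orderable (children (subtree E B \<tau>) u) (hd u)"
    using witness_treeD(7)[OF \<tau> u'] children_subtree[OF ne last] ne by simp
next
  fix B' u assume "B' # u \<in> subtree E B \<tau> \<and> u \<noteq> []"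
  then show "u \<in> subtree E B \<tau>"
    using witness_treeD(5)[OF \<tau>, of B' "u @ [E]"] by (simp add: subtree_def split: if_splits)
qed

lemma witness_tree_decompose:
  assumes \<tau>: "witness_tree \<B> E \<tau>"
  shows "\<tau> = insert [E] (\<Union>B \<in> children \<tau> [E]. (\<lambda>u. u @ [E]) ` subtree E B \<tau>)"
proof (intro equalityI subsetI)
  fix u assume u: "u \<in> \<tau>"
  then have u_eq: "u = butlast u @ [E]"
    using append_butlast_last_id witness_treeD(3,4)[OF \<tau>] by metis
  show "u \<in> insert [E] (\<Union>B \<in> children \<tau> [E]. (\<lambda>u. u @ [E]) ` subtree E B \<tau>)"
  proof (cases "butlast u = []")
    case True
    then show ?thesis using u_eq by simp
  next
    case False
    have "butlast u @ [E] \<in> \<tau>" using u u_eq by simp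
    then have "butlast u \<in> subtree E (last (butlast u)) \<tau>"
        "last (butlast u) \<in> children \<tau> [E]"
      using False witness_tree_ancestor[OF \<tau>] by (simp_all add: subtree_def)
    then show ?thesis using u_eq by blast
  qed
next
  fix u assume "u \<in> insert [E] (\<Union>B \<in> children \<tau> [E]. (\<lambda>u. u @ [E]) ` subtree E B \<tau>)"
  then show "u \<in> \<tau>" using witness_treeD(2)[OF \<tau>] by (auto simp: subtree_def)
qed

text \<open>Paths through distinct children of the root form disjoint families, because their
  next-to-last entries differ; hence the weights multiply.\<close>

lemma tree_weight_decompose:
  assumes \<tau>: "witness_tree \<B> E \<tau>" and fin: "finite (children \<tau> [E])"
  shows "tree_weight P \<tau> = P E * (\<Prod>B \<in> children \<tau> [E]. tree_weight P (subtree E B \<tau>))"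
proof -
  let ?S = "\<lambda>B. (\<lambda>u. u @ [E]) ` subtree E B \<tau>"
  have finS: "finite (?S B)" if "B \<in> children \<tau> [E]" for B
    using witness_treeD(1)[OF witness_tree_subtree[OF \<tau> that]] by simp
  have "tree_weight P \<tau> = tree_weight P (insert [E] (\<Union>B \<in> children \<tau> [E]. ?S B))"
    by (rule arg_cong[OF witness_tree_decompose[OF \<tau>]])
  also have "\<dots> = P E * (\<Prod>u \<in> (\<Union>B \<in> children \<tau> [E]. ?S B). P (hd u))"
    unfolding tree_weight_def using fin finS by (subst prod.insert) (auto simp: subtree_def)
  also have "(\<Prod>u \<in> (\<Union>B \<in> children \<tau> [E]. ?S B). P (hd u)) =
      (\<Prod>B \<in> children \<tau> [E]. \<Prod>u \<in> ?S B. P (hd u))"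
    using fin finS by (intro prod.UNION_disjoint) (auto simp: subtree_def)
  also have "\<dots> = (\<Prod>B \<in> children \<tau> [E]. tree_weight P (subtree E B \<tau>))"
  proof (rule prod.cong[OF refl])
    fix B assume "B \<in> children \<tau> [E]"
    have "inj_on (\<lambda>u. u @ [E]) (subtree E B \<tau>)" by (simp add: inj_on_def)
    then show "(\<Prod>u \<in> ?S B. P (hd u)) = tree_weight P (subtree E B \<tau>)"
      unfolding tree_weight_def
      by (simp add: prod.reindex) (auto simp: subtree_def intro: prod.cong)
  qed
  finally show ?thesis .
qed

lemma tree_weight_nonneg: "(\<And>B. 0 \<le> P B) \<Longrightarrow> 0 \<le> tree_weight P \<tau>"
  by (simp add: tree_weight_def prod_nonneg)

text \<open>A tree is determined by the child set \<open>Y\<close> of its root and one shallower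
  tree for each member of \<open>Y\<close>. Summing over all such data gives \<open>P E\<close>
  times a sum over orderable \<open>Y\<close> of products of total weights, which the induction
  hypothesis and \<open>cond\<close> bound.\<close>

lemma sum_tree_weight_le:
  fixes P \<mu> :: "'v bev \<Rightarrow> real"
  assumes fin: "finite \<B>" and P: "\<And>B. 0 \<le> P B" and \<mu>: "\<And>B. B \<in> \<B> \<Longrightarrow> 0 \<le> \<mu> B"
    and cond: "\<And>B. B \<in> \<B> \<Longrightarrow>
      P B * (\<Sum>Y \<in> {Y. Y \<subseteq> \<B> \<and> orderable Y B}. \<Prod>B' \<in> Y. \<mu> B') \<le> \<mu> B"
  shows "E \<in> \<B> \<Longrightarrow> (\<Sum>\<tau> \<in> witness_trees \<B> T E. tree_weight P \<tau>) \<le> \<mu> E"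
proof (induction T arbitrary: E)
  case 0
  have "witness_trees \<B> 0 E = {}"
    using witness_treeD(2) by (force simp: witness_trees_def)
  then show ?case using \<mu> 0 by simp
next
  case (Suc T)
  define W where "W = witness_trees \<B> T"
  define \<Y> where "\<Y> = {Y. Y \<subseteq> \<B> \<and> orderable Y E}"
  \<comment> \<open>\<open>restrict\<close> fixes the values outside the child set, so that the
    second component is a member of \<open>PiE\<close>.\<close>
  define \<phi> where "\<phi> \<tau> = (children \<tau> [E], restrict (\<lambda>B. subtree E B \<tau>) (children \<tau> [E]))" for \<tau>
  define g where "g = (\<lambda>(Y :: 'v bev set, F). P E * (\<Prod>B \<in> Y. tree_weight P (F B)))"
  have fin\<Y>: "finite \<Y>" using fin by (simp add: \<Y>_def)
  have finY: "finite Y" if "Y \<in> \<Y>" for Y using that fin finite_subset by (auto simp: \<Y>_def)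
  have finW: "finite (W B)" if "B \<in> \<B>" for B
    unfolding W_def by (rule finite_witness_trees[OF fin that])
  have wt: "witness_tree \<B> E \<tau>" if "\<tau> \<in> witness_trees \<B> (Suc T) E" for \<tau>
    using that by (simp add: witness_trees_def)
  have ch: "children \<tau> [E] \<in> \<Y>" if "\<tau> \<in> witness_trees \<B> (Suc T) E" for \<tau>
    using witness_treeD(6,7)[OF wt[OF that] witness_treeD(2)[OF wt[OF that]]] by (simp add: \<Y>_def)
  have sub: "subtree E B \<tau> \<in> W B"
    if "\<tau> \<in> witness_trees \<B> (Suc T) E" "B \<in> children \<tau> [E]" for B \<tau>
  proof -
    have "\<forall>u \<in> subtree E B \<tau>. length u \<le> T"
      using that(1) by (auto simp: witness_trees_def subtree_def)
    then show ?thesis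
      using witness_tree_subtree[OF wt[OF that(1)] that(2)] by (simp add: W_def witness_trees_def)
  qed
  have inj: "inj_on \<phi> (witness_trees \<B> (Suc T) E)"
  proof (rule inj_onI)
    fix \<tau> \<tau>' assume \<tau>: "\<tau> \<in> witness_trees \<B> (Suc T) E" "\<tau>' \<in> witness_trees \<B> (Suc T) E"
      and eq: "\<phi> \<tau> = \<phi> \<tau>'"
    then have c: "children \<tau> [E] = children \<tau>' [E]" by (simp add: \<phi>_def)
    have "subtree E B \<tau> = subtree E B \<tau>'" if "B \<in> children \<tau> [E]" for B
    proof -
      have "snd (\<phi> \<tau>) B = snd (\<phi> \<tau>') B" using eq by simp
      then show ?thesis using that c by (simp add: \<phi>_def)
    qed
    then have "insert [E] (\<Union>B \<in> children \<tau> [E]. (\<lambda>u. u @ [E]) ` subtree E B \<tau>) =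
        insert [E] (\<Union>B \<in> children \<tau>' [E]. (\<lambda>u. u @ [E]) ` subtree E B \<tau>')"
      using c by simp
    then show "\<tau> = \<tau>'"
      by (rule trans[OF witness_tree_decompose[OF wt[OF \<tau>(1)]]
            trans[OF _ sym[OF witness_tree_decompose[OF wt[OF \<tau>(2)]]]]])
  qed
  have img: "\<phi> ` witness_trees \<B> (Suc T) E \<subseteq> Sigma \<Y> (\<lambda>Y. PiE Y W)"
  proof
    fix x assume "x \<in> \<phi> ` witness_trees \<B> (Suc T) E"
    then obtain \<tau> where \<tau>: "\<tau> \<in> witness_trees \<B> (Suc T) E" "x = \<phi> \<tau>" by blast
    then show "x \<in> Sigma \<Y> (\<lambda>Y. PiE Y W)"
      using ch[OF \<tau>(1)] sub[OF \<tau>(1)] by (simp add: \<phi>_def)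
  qed
  have "(\<Sum>\<tau> \<in> witness_trees \<B> (Suc T) E. tree_weight P \<tau>) =
      (\<Sum>\<tau> \<in> witness_trees \<B> (Suc T) E. g (\<phi> \<tau>))"
  proof (rule sum.cong[OF refl])
    fix \<tau> assume \<tau>: "\<tau> \<in> witness_trees \<B> (Suc T) E"
    show "tree_weight P \<tau> = g (\<phi> \<tau>)"
      using tree_weight_decompose[OF wt[OF \<tau>] finY[OF ch[OF \<tau>]]] by (simp add: g_def \<phi>_def)
  qed
  also have "\<dots> = sum g (\<phi> ` witness_trees \<B> (Suc T) E)"
    by (simp add: sum.reindex[OF inj])
  \<comment> \<open>Passing from the image to all pairs of an orderable set and a family of trees
    only adds nonnegative terms.\<close>
  also have "\<dots> \<le> sum g (Sigma \<Y> (\<lambda>Y. PiE Y W))"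
  proof (rule sum_mono2[OF _ img])
    show "finite (Sigma \<Y> (\<lambda>Y. PiE Y W))"
    proof (rule finite_SigmaI[OF fin\<Y>])
      fix Y assume Y: "Y \<in> \<Y>"
      then have "Y \<subseteq> \<B>" by (simp add: \<Y>_def)
      then show "finite (PiE Y W)" using finY[OF Y] finW by (intro finite_PiE) auto
    qed
    show "\<And>x. 0 \<le> g x"
      using P by (auto simp: g_def intro!: mult_nonneg_nonneg prod_nonneg tree_weight_nonneg)
  qed
  also have "\<dots> = (\<Sum>Y \<in> \<Y>. \<Sum>F \<in> PiE Y W. g (Y, F))"
  proof (subst sum.Sigma)
    show "\<forall>Y \<in> \<Y>. finite (PiE Y W)"
    proof
      fix Y assume Y: "Y \<in> \<Y>"
      then have "Y \<subseteq> \<B>" by (simp add: \<Y>_def)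
      then show "finite (PiE Y W)" using finY[OF Y] finW by (intro finite_PiE) auto
    qed
  qed (auto simp: fin\<Y>)
  also have "\<dots> = (\<Sum>Y \<in> \<Y>. P E * (\<Prod>B \<in> Y. \<Sum>\<tau> \<in> W B. tree_weight P \<tau>))"
  proof (rule sum.cong[OF refl])
    fix Y assume Y: "Y \<in> \<Y>"
    then have "Y \<subseteq> \<B>" by (simp add: \<Y>_def)
    then have "(\<Prod>B \<in> Y. \<Sum>\<tau> \<in> W B. tree_weight P \<tau>) = (\<Sum>F \<in> PiE Y W. \<Prod>B \<in> Y. tree_weight P (F B))"
      using finY[OF Y] finW by (intro prod_sum_PiE) auto
    then show "(\<Sum>F \<in> PiE Y W. g (Y, F)) = P E * (\<Prod>B \<in> Y. \<Sum>\<tau> \<in> W B. tree_weight P \<tau>)"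
      by (simp add: g_def sum_distrib_left)
  qed
  also have "\<dots> \<le> (\<Sum>Y \<in> \<Y>. P E * (\<Prod>B \<in> Y. \<mu> B))"
  proof (rule sum_mono)
    fix Y assume Y: "Y \<in> \<Y>"
    then have "Y \<subseteq> \<B>" by (simp add: \<Y>_def)
    then show "P E * (\<Prod>B \<in> Y. \<Sum>\<tau> \<in> W B. tree_weight P \<tau>) \<le> P E * (\<Prod>B \<in> Y. \<mu> B)"
      using P Suc.IH by (intro mult_left_mono prod_mono) (auto simp: W_def intro!: sum_nonneg tree_weight_nonneg)
  qed
  also have "\<dots> = P E * (\<Sum>Y \<in> \<Y>. \<Prod>B \<in> Y. \<mu> B)" by (simp add: sum_distrib_left)
  also have "\<dots> \<le> \<mu> E" unfolding \<Y>_def by (rule cond[OF Suc.prems])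
  finally show ?case .
qed

subsection \<open>The Moser--Tardos process\<close>

lemma expectation_bind_pmf_finite:
  fixes f :: "'b \<Rightarrow> real"
  assumes "finite (set_pmf M)" "\<And>x. x \<in> set_pmf M \<Longrightarrow> finite (set_pmf (N x))"
  shows "measure_pmf.expectation (bind_pmf M N) f =
    measure_pmf.expectation M (\<lambda>x. measure_pmf.expectation (N x) f)"
  using pmf_expectation_bind[of "set_pmf M" N M f] assms
    integral_measure_pmf[of "set_pmf M" M "\<lambda>x. measure_pmf.expectation (N x) f"]
  by simp

lemma expectation_mono_finite:
  fixes f g :: "'a \<Rightarrow> real"
  assumes "finite (set_pmf M)" "\<And>x. x \<in> set_pmf M \<Longrightarrow> f x \<le> g x"
  shows "measure_pmf.expectation M f \<le> measure_pmf.expectation M g"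
  using assms by (intro integral_mono_AE integrable_measure_pmf_finite) (auto simp: AE_measure_pmf_iff)

lemma expectation_if_const:
  "measure_pmf.expectation M (\<lambda>x. if P x then c else 0) = c * measure_pmf.prob M {x. P x}"
  for c :: real
proof -
  have "(\<lambda>x. if P x then c else 0) = (\<lambda>x. c * indicator {x. P x} x)" by auto
  then show ?thesis by simp
qed

section \<open>Probabilities of sets of pairs under the product distribution and under
  resampling\<close>

lemma holds_iff: "holds a C \<longleftrightarrow> (\<forall>i j. (i, j) \<in> C \<longrightarrow> a i = j)"
  by (auto simp: holds_def)

text \<open>The universal quantifier gives 1 at a variable outside \<open>C\<close> and 0 at a
  variable with two distinct values in \<open>C\<close>. The product formula thus covers frontiers,
  which need not be partial functions.\<close>

definition agree_prob :: "(nat \<Rightarrow> 'v pmf) \<Rightarrow> 'v bev \<Rightarrow> nat \<Rightarrow> real" where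
  "agree_prob p C i = measure_pmf.prob (p i) {x. \<forall>j. (i, j) \<in> C \<longrightarrow> x = j}"

lemma agree_prob_nonneg: "0 \<le> agree_prob p C i"
  by (simp add: agree_prob_def)

lemma agree_prob_le_1: "agree_prob p C i \<le> 1"
  by (simp add: agree_prob_def)

lemma agree_prob_eq_1: "i \<notin> fst ` C \<Longrightarrow> agree_prob p C i = 1"
proof -
  assume "i \<notin> fst ` C"
  then have "{x. \<forall>j. (i, j) \<in> C \<longrightarrow> x = j} = UNIV" by force
  then show ?thesis by (simp add: agree_prob_def)
qed

lemma agree_prob_cong:
  "(\<And>j. (i, j) \<in> C \<longleftrightarrow> (i, j) \<in> D) \<Longrightarrow> agree_prob p C i = agree_prob p D i"
  by (simp add: agree_prob_def)

lemma prob_Pi_pmf_holds: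
  assumes "finite A" "fst ` C \<subseteq> A"
  shows "measure_pmf.prob (Pi_pmf A dflt p) {a. holds a C} = (\<Prod>i \<in> A. agree_prob p C i)"
proof -
  have "{a. holds a C} = Pi A (\<lambda>i. {x. \<forall>j. (i, j) \<in> C \<longrightarrow> x = j})"
    using assms(2) by (force simp: holds_def)
  then show ?thesis
    using assms(1) by (simp add: measure_Pi_pmf_Pi agree_prob_def)
qed

lemma PO_eq_prod: "fst ` C \<subseteq> {..<n} \<Longrightarrow> PO n p C = (\<Prod>i<n. agree_prob p C i)"
  unfolding PO_def Omega_def by (rule prob_Pi_pmf_holds) auto

lemma PO_nonneg: "0 \<le> PO n p C"
  by (simp add: PO_def)

text \<open>Fresh values decide the pairs of \<open>C\<close> over the variables of
  \<open>B\<close>, and the old state decides all other pairs.\<close>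

lemma prob_resample_holds:
  assumes "finite B"
  shows "measure_pmf.prob (resample p a B) {a'. holds a' C} =
    (if holds a {(i, j) \<in> C. i \<notin> fst ` B} then \<Prod>i \<in> fst ` B. agree_prob p C i else 0)"
proof -
  let ?D = "{(i, j) \<in> C. i \<in> fst ` B}"
  have eq: "holds (\<lambda>i. if i \<in> fst ` B then g i else a i) C \<longleftrightarrow>
      holds g ?D \<and> holds a {(i, j) \<in> C. i \<notin> fst ` B}" for g
    unfolding holds_iff by (auto split: if_splits)
  have "measure_pmf.prob (Pi_pmf (fst ` B) undefined p) {g. holds g ?D} =
      (\<Prod>i \<in> fst ` B. agree_prob p ?D i)"
    using assms by (intro prob_Pi_pmf_holds) force+
  also have "\<dots> = (\<Prod>i \<in> fst ` B. agree_prob p C i)"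
    by (intro prod.cong refl agree_prob_cong) auto
  finally show ?thesis
    unfolding resample_def measure_map_pmf vimage_def mem_Collect_eq eq by simp
qed

section \<open>The potential of a witness tree\<close>

definition potential :: "nat \<Rightarrow> (nat \<Rightarrow> 'v pmf) \<Rightarrow> 'v bev list set \<Rightarrow> 'v asg \<Rightarrow> real" where
  "potential n p \<tau> a =
     (if holds a (frontier \<tau>) then tree_weight (PO n p) \<tau> / PO n p (frontier \<tau>) else 0)"

lemma potential_nonneg: "0 \<le> potential n p \<tau> a"
  by (simp add: potential_def tree_weight_nonneg PO_nonneg)

text \<open>Equality holds unless the frontier has probability 0; the left side is then 0, while the
  weight may be positive.\<close>

lemma expectation_potential_le:
  "measure_pmf.expectation (Omega n p) (potential n p \<tau>) \<le> tree_weight (PO n p) \<tau>"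
proof -
  have "measure_pmf.expectation (Omega n p) (potential n p \<tau>) =
      tree_weight (PO n p) \<tau> / PO n p (frontier \<tau>) * PO n p (frontier \<tau>)"
    unfolding potential_def expectation_if_const PO_def ..
  then show ?thesis by (simp add: tree_weight_nonneg PO_nonneg)
qed

lemma PO_pos:
  assumes "a \<in> set_pmf (Omega n p)" "holds a B"
  shows "0 < PO n p B"
  unfolding PO_def using assms by (intro measure_pmf_posI) auto

text \<open>The support condition excludes the degenerate quotient 0/0. The value 1 later pays for
  one resampling of \<open>B\<close>.\<close>

lemma potential_singleton:
  assumes "a \<in> set_pmf (Omega n p)" "holds a B"
  shows "potential n p {[B]} a = 1"
  using PO_pos[OF assms] assms(2) by (simp add: potential_def frontier_singleton tree_weight_def)

text \<open>The frontier splits into a part over the variables of \<open>B\<close>, met by fresh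
  values with probability \<open>R\<close>, and a part \<open>C'\<close> over other variables, of
  probability \<open>Q\<close>. If a node is added, \<open>B\<close> replaces the first part: weight
  and frontier probability both gain the factor \<open>PO n p B\<close>, and the quotient becomes
  \<open>w / Q\<close>. If \<open>B\<close> is discarded, the first part is contained in
  \<open>B\<close>, so \<open>a\<close> already satisfies it, and \<open>R\<close> is at most
  1.\<close>

lemma expectation_potential_resample_le:
  assumes \<tau>: "finite \<tau>" "fst ` frontier \<tau> \<subseteq> {..<n}"
    and B: "finite B" "inj_on fst B" "fst ` B \<subseteq> {..<n}"
    and a: "a \<in> set_pmf (Omega n p)" "holds a B"
  shows "measure_pmf.expectation (resample p a B) (potential n p \<tau>) \<le> potential n p (attach B \<tau>) a"
proof -
  define w where "w = tree_weight (PO n p) \<tau>"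
  define C where "C = frontier \<tau>"
  define C' where "C' = {(i, j) \<in> C. i \<notin> fst ` B}"
  define R where "R = (\<Prod>i \<in> fst ` B. agree_prob p C i)"
  have w: "0 \<le> w" unfolding w_def by (intro tree_weight_nonneg PO_nonneg)
  have R: "0 \<le> R" "R \<le> 1"
    unfolding R_def by (auto intro: prod_nonneg prod_le_1 simp: agree_prob_nonneg agree_prob_le_1)
  have lhs: "measure_pmf.expectation (resample p a B) (potential n p \<tau>) =
      (if holds a C' then w / PO n p C * R else 0)"
    unfolding potential_def expectation_if_const prob_resample_holds[OF B(1)]
    by (simp add: w_def C_def C'_def R_def)
  from \<tau>(1) show ?thesis
  proof (cases rule: attach_cases[where B = B])
    case skip
    have "holds a C" if "holds a C'"
    proof -
      have "(i, j) \<in> C' \<or> (i, j) \<in> B" if "(i, j) \<in> C" for i j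
        using that frontier_skip[OF skip(1)] by (auto simp: C'_def C_def)
      then show ?thesis using that a(2) unfolding holds_iff by blast
    qed
    moreover have "w / PO n p C * R \<le> w / PO n p C"
      using R w by (intro mult_left_le) (auto simp: PO_nonneg)
    ultimately show ?thesis
      unfolding lhs skip(2) using w by (auto simp: potential_def C_def w_def PO_nonneg)
  next
    case (add u)
    define Q where "Q = (\<Prod>i \<in> {..<n} - fst ` B. agree_prob p C i)"
    have split: "(\<Prod>i<n. f i) = (\<Prod>i \<in> fst ` B. f i) * (\<Prod>i \<in> {..<n} - fst ` B. f i)" for f :: "nat \<Rightarrow> real"
      using prod.subset_diff[OF B(3), of f] by (simp add: mult.commute)
    have fr: "frontier (attach B \<tau>) = B \<union> C'"
      unfolding add(3) C'_def C_def by (rule frontier_add[OF \<tau>(1) B(2) add(2)])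
    have PO_C: "PO n p C = R * Q"
      using \<tau>(2) by (simp add: PO_eq_prod split R_def Q_def C_def)
    have PO_B: "PO n p B = (\<Prod>i \<in> fst ` B. agree_prob p B i)"
      using B(3) by (simp add: PO_eq_prod split agree_prob_eq_1)
    have "fst ` (B \<union> C') \<subseteq> {..<n}" using B(3) \<tau>(2) by (force simp: C'_def C_def)
    then have "PO n p (B \<union> C') =
        (\<Prod>i \<in> fst ` B. agree_prob p (B \<union> C') i) * (\<Prod>i \<in> {..<n} - fst ` B. agree_prob p (B \<union> C') i)"
      by (simp add: PO_eq_prod split)
    also have "(\<Prod>i \<in> fst ` B. agree_prob p (B \<union> C') i) = (\<Prod>i \<in> fst ` B. agree_prob p B i)"
      by (intro prod.cong refl agree_prob_cong) (auto simp: C'_def)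
    also have "(\<Prod>i \<in> {..<n} - fst ` B. agree_prob p (B \<union> C') i) = Q"
      unfolding Q_def by (intro prod.cong refl agree_prob_cong) (force simp: C'_def)
    finally have PO_BC: "PO n p (B \<union> C') = PO n p B * Q" by (simp add: PO_B)
    have "B # u \<notin> \<tau>" by (rule attachable_not_child[OF add(1)])
    then have weight: "tree_weight (PO n p) (attach B \<tau>) = PO n p B * w"
      using \<tau>(1) by (simp add: add(3) tree_weight_def w_def)
    have holds: "holds a (B \<union> C') \<longleftrightarrow> holds a C'"
      using a(2) by (auto simp: holds_iff)
    have "0 \<le> Q" unfolding Q_def by (intro prod_nonneg) (simp add: agree_prob_nonneg)
    \<comment> \<open>For \<open>R = 0\<close> the left side is 0 by the convention on division;
      otherwise \<open>R\<close> cancels.\<close>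
    then have "w / (R * Q) * R \<le> w / Q" using w by (cases "R = 0") auto
    then show ?thesis
      unfolding lhs potential_def fr weight holds PO_C PO_BC using PO_pos[OF a] by simp
  qed
qed

section \<open>Supports and resampling counts\<close>

lemma resample_in_Omega:
  assumes a: "a \<in> set_pmf (Omega n p)" and B: "finite B" "fst ` B \<subseteq> {..<n}"
    and a': "a' \<in> set_pmf (resample p a B)"
  shows "a' \<in> set_pmf (Omega n p)"
proof -
  obtain g where "g \<in> set_pmf (Pi_pmf (fst ` B) undefined p)"
      and "a' = (\<lambda>i. if i \<in> fst ` B then g i else a i)"
    using a' by (auto simp: resample_def)
  then show ?thesis
    using a B by (auto simp: Omega_def set_Pi_pmf PiE_dflt_def)
qed

lemma finite_set_Pi_pmf:
  assumes "finite A" "\<And>i. i \<in> A \<Longrightarrow> finite (set_pmf (p i))"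
  shows "finite (set_pmf (Pi_pmf A dflt p))"
  using assms by (auto simp: set_Pi_pmf)

lemma finite_set_resample:
  assumes "finite B" "\<And>i. i \<in> fst ` B \<Longrightarrow> finite (set_pmf (p i))"
  shows "finite (set_pmf (resample p a B))"
  unfolding resample_def using assms by (auto intro!: finite_set_Pi_pmf)

lemma resample_count_append:
  assumes "h \<noteq> []"
  shows "resample_count sel B (h @ [a]) = resample_count sel B h + (if sel h = B then 1 else 0)"
proof -
  let ?K = "{k. Suc k < length h \<and> sel (take (Suc k) h) = B}"
  have "finite {k. Suc k < length h}" by (rule finite_subset[of _ "{..<length h}"]) auto
  then have fin: "finite ?K" by (rule finite_subset[rotated]) auto
  \<comment> \<open>The appended transition has index \<open>length h - 1\<close>, and the prefix
    that selected its event is all of \<open>h\<close>.\<close>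
  have "Suc k < length (h @ [a]) \<and> sel (take (Suc k) (h @ [a])) = B \<longleftrightarrow>
      k \<in> ?K \<or> k = length h - 1 \<and> sel h = B" for k
  proof (cases "Suc k < length h")
    case False
    moreover have "take (length h) (h @ [a]) = h" by simp
    moreover have "Suc k < length (h @ [a]) \<longleftrightarrow> Suc k = length h \<or> Suc k < length h" by auto
    moreover have "k = length h - 1 \<longleftrightarrow> Suc k = length h" using assms by (cases h) auto
    ultimately show ?thesis by auto
  next
    case True
    then show ?thesis by auto
  qed
  then have "{k. Suc k < length (h @ [a]) \<and> sel (take (Suc k) (h @ [a])) = B} =
      (if sel h = B then insert (length h - 1) ?K else ?K)"
    by auto
  moreover have "length h - 1 \<notin> ?K" using assms by simp
  ultimately show ?thesis using fin by (simp add: resample_count_def)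
qed

section \<open>The process for a fixed selection rule\<close>

locale moser_tardos =
  fixes n :: nat and p :: "nat \<Rightarrow> 'v pmf" and \<B> :: "'v bev set" and sel :: "'v asg list \<Rightarrow> 'v bev"
  assumes finite_vals: "\<And>i. i < n \<Longrightarrow> finite (set_pmf (p i))"
    and finite_B: "finite \<B>"
    and atomic: "\<And>B. B \<in> \<B> \<Longrightarrow> finite B \<and> inj_on fst B \<and> fst ` B \<subseteq> {..<n}"
    and rule: "valid_rule \<B> sel"
begin

abbreviation hist :: "nat \<Rightarrow> 'v asg list pmf" where
  "hist \<equiv> mt_hist \<B> n p sel"

abbreviation step :: "'v asg list \<Rightarrow> 'v asg list pmf" where
  "step \<equiv> mt_step \<B> p sel"

text \<open>An invariant of the histories that occur; the support condition gives positive
  probability to every event true in the current state.\<close>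

definition reachable :: "'v asg list \<Rightarrow> bool" where
  "reachable h \<longleftrightarrow> h \<noteq> [] \<and> last h \<in> set_pmf (Omega n p)"

lemma sel_true:
  assumes "reachable h" "some_true \<B> (last h)"
  shows "sel h \<in> \<B>" "holds (last h) (sel h)"
  using rule assms by (auto simp: valid_rule_def reachable_def)

lemma reachable_step:
  assumes h: "reachable h" and h': "h' \<in> set_pmf (step h)"
  shows "reachable h'"
proof (cases "some_true \<B> (last h)")
  case True
  then obtain a' where "a' \<in> set_pmf (resample p (last h) (sel h))" "h' = h @ [a']"
    using h' by (auto simp: mt_step_def)
  then show ?thesis
    using resample_in_Omega atomic[OF sel_true(1)[OF h True]] h by (auto simp: reachable_def)
next
  case False
  then show ?thesis using h h' by (simp add: mt_step_def)
qed

lemma reachable_hist: "h \<in> set_pmf (hist t) \<Longrightarrow> reachable h"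
proof (induction t arbitrary: h)
  case 0
  then show ?case by (auto simp: reachable_def)
next
  case (Suc t)
  then show ?case using reachable_step by auto
qed

lemma finite_resample: "B \<in> \<B> \<Longrightarrow> finite (set_pmf (resample p a B))"
  using atomic finite_vals by (intro finite_set_resample) blast+

lemma finite_step: "reachable h \<Longrightarrow> finite (set_pmf (step h))"
  using sel_true(1) finite_resample by (auto simp: mt_step_def)

lemma finite_Omega: "finite (set_pmf (Omega n p))"
  unfolding Omega_def using finite_vals by (intro finite_set_Pi_pmf) auto

lemma finite_hist: "finite (set_pmf (hist t))"
  by (induction t) (auto simp: finite_Omega intro: finite_step reachable_hist)

lemma expectation_hist_Suc:
  fixes f :: "'v asg list \<Rightarrow> real"
  shows "measure_pmf.expectation (hist (Suc t)) f =
    measure_pmf.expectation (hist t) (\<lambda>h. measure_pmf.expectation (step h) f)"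
  using finite_hist finite_step reachable_hist by (simp add: expectation_bind_pmf_finite)

lemma frontier_subset:
  assumes \<tau>: "witness_tree \<B> E \<tau>" and E: "E \<in> \<B>"
  shows "fst ` frontier \<tau> \<subseteq> {..<n}"
proof
  fix i assume "i \<in> fst ` frontier \<tau>"
  then obtain u where u: "u \<in> \<tau>" "i \<in> fst ` hd u" by (force simp: frontier_def)
  have "hd u \<in> \<B>"
    using witness_tree_labels[OF \<tau> E u(1)] witness_treeD(3)[OF \<tau> u(1)] by (cases u) auto
  then show "i \<in> {..<n}" using atomic u(2) by blast
qed

section \<open>The supermartingale and the bound on expected counts\<close>

definition predicted :: "'v bev \<Rightarrow> nat \<Rightarrow> 'v asg list \<Rightarrow> real" where
  "predicted B T h =
     resample_count sel B h + (\<Sum>\<tau> \<in> witness_trees \<B> T B. potential n p \<tau> (last h))"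

lemma expectation_step_predicted_le:
  assumes B: "B \<in> \<B>" and h: "reachable h"
  shows "measure_pmf.expectation (step h) (predicted B T) \<le> predicted B (Suc T) h"
proof (cases "some_true \<B> (last h)")
  case True
  define D where "D = sel h"
  define a where "a = last h"
  define W where "W = witness_trees \<B> T B"
  define W' where "W' = witness_trees \<B> (Suc T) B"
  define c where "c = (if D = B then 1 else 0 :: real)"
  have D: "D \<in> \<B>" "holds a D" using sel_true[OF h True] by (simp_all add: D_def a_def)
  have a: "a \<in> set_pmf (Omega n p)" and ne: "h \<noteq> []" using h by (simp_all add: reachable_def a_def)
  have finW': "finite W'" unfolding W'_def by (rule finite_witness_trees[OF finite_B B])
  have wt: "witness_tree \<B> B \<tau>" if "\<tau> \<in> W" for \<tau> using that by (simp add: W_def witness_trees_def)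
  have inj: "inj_on (attach D) W"
    by (rule inj_on_subset[OF inj_on_attach]) (use wt in blast)
  have img: "attach D ` W \<subseteq> W'"
    unfolding W_def W'_def using attach_in_witness_trees D(1) by blast
  have finD: "finite (set_pmf (resample p a D))" by (rule finite_resample[OF D(1)])
  have "measure_pmf.expectation (step h) (predicted B T) =
      measure_pmf.expectation (resample p a D)
        (\<lambda>a'. (resample_count sel B h + c) + (\<Sum>\<tau> \<in> W. potential n p \<tau> a'))"
    using True ne
    by (simp add: mt_step_def predicted_def resample_count_append D_def a_def W_def c_def add_ac)
  also have "\<dots> = resample_count sel B h + c +
      (\<Sum>\<tau> \<in> W. measure_pmf.expectation (resample p a D) (potential n p \<tau>))"
    by (simp add: integrable_measure_pmf_finite[OF finD])
  also have "\<dots> \<le> resample_count sel B h + c + (\<Sum>\<tau> \<in> W. potential n p (attach D \<tau>) a)"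
  proof (intro add_left_mono sum_mono)
    fix \<tau> assume "\<tau> \<in> W"
    from witness_treeD(1)[OF wt[OF this]] frontier_subset[OF wt[OF this] B]
    show "measure_pmf.expectation (resample p a D) (potential n p \<tau>) \<le> potential n p (attach D \<tau>) a"
      using atomic[OF D(1)] a D(2) by (intro expectation_potential_resample_le) blast+
  qed
  also have "(\<Sum>\<tau> \<in> W. potential n p (attach D \<tau>) a) = (\<Sum>\<tau> \<in> attach D ` W. potential n p \<tau> a)"
    by (simp add: sum.reindex[OF inj])
  finally have "measure_pmf.expectation (step h) (predicted B T) \<le>
      resample_count sel B h + c + (\<Sum>\<tau> \<in> attach D ` W. potential n p \<tau> a)" .
  \<comment> \<open>An increase of the count is paid for by the tree \<open>{[B]}\<close>, whose
    potential is 1 and which no attachment produces.\<close>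
  moreover have "c + (\<Sum>\<tau> \<in> attach D ` W. potential n p \<tau> a) \<le> (\<Sum>\<tau> \<in> W'. potential n p \<tau> a)"
  proof (cases "D = B")
    case True
    have "orderable {} B" by (auto simp: orderable_def)
    then have "{[B]} \<in> W'"
      by (simp add: W'_def witness_trees_def witness_tree_def children_def)
    moreover have "{[B]} \<notin> attach D ` W"
      using attach_neq_singleton[OF wt] unfolding True by (metis imageE)
    moreover have "finite (attach D ` W)" using finW' img by (rule finite_subset[rotated])
    ultimately have "c + (\<Sum>\<tau> \<in> attach D ` W. potential n p \<tau> a) =
        (\<Sum>\<tau> \<in> insert {[B]} (attach D ` W). potential n p \<tau> a)"
      using potential_singleton[OF a, of B] D(2) True by (simp add: c_def)
    also have "\<dots> \<le> (\<Sum>\<tau> \<in> W'. potential n p \<tau> a)"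
      using finW' img \<open>{[B]} \<in> W'\<close> by (intro sum_mono2) (auto simp: potential_nonneg)
    finally show ?thesis .
  next
    case False
    then show ?thesis
      using sum_mono2[OF finW' img, of "\<lambda>\<tau>. potential n p \<tau> a"]
      by (simp add: c_def potential_nonneg)
  qed
  ultimately show ?thesis by (simp add: predicted_def W'_def a_def)
next
  case False
  \<comment> \<open>After termination the history is frozen and only the depth bound grows.\<close>
  have "(\<Sum>\<tau> \<in> witness_trees \<B> T B. potential n p \<tau> (last h)) \<le>
      (\<Sum>\<tau> \<in> witness_trees \<B> (Suc T) B. potential n p \<tau> (last h))"
    using finite_witness_trees[OF finite_B B]
    by (intro sum_mono2) (auto simp: witness_trees_def potential_nonneg)
  then show ?thesis using False by (simp add: mt_step_def predicted_def)
qed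

lemma expectation_hist_predicted_le:
  assumes B: "B \<in> \<B>"
  shows "measure_pmf.expectation (hist t) (predicted B T) \<le>
    measure_pmf.expectation (hist 0) (predicted B (T + t))"
proof (induction t arbitrary: T)
  case (Suc t)
  have "measure_pmf.expectation (hist (Suc t)) (predicted B T) \<le>
      measure_pmf.expectation (hist t) (predicted B (Suc T))"
    unfolding expectation_hist_Suc
    by (intro expectation_mono_finite finite_hist expectation_step_predicted_le[OF B] reachable_hist)
  also have "\<dots> \<le> measure_pmf.expectation (hist 0) (predicted B (Suc T + t))" by (rule Suc.IH)
  finally show ?case by simp
qed simp

lemma expectation_resample_count_le:
  assumes B: "B \<in> \<B>"
  shows "measure_pmf.expectation (hist t) (\<lambda>h. real (resample_count sel B h)) \<le>
    (\<Sum>\<tau> \<in> witness_trees \<B> t B. tree_weight (PO n p) \<tau>)"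
proof -
  \<comment> \<open>Potentials are nonnegative, so any depth bound works here; choosing 0 at time
    \<open>t\<close> leads to depth \<open>t\<close> at time 0.\<close>
  have "measure_pmf.expectation (hist t) (\<lambda>h. real (resample_count sel B h)) \<le>
      measure_pmf.expectation (hist t) (predicted B 0)"
    by (intro expectation_mono_finite finite_hist)
      (auto simp: predicted_def intro: sum_nonneg potential_nonneg)
  also have "\<dots> \<le> measure_pmf.expectation (hist 0) (predicted B t)"
    using expectation_hist_predicted_le[OF B, of t 0] by simp
  \<comment> \<open>Nothing has been resampled at time 0, so only the potentials remain.\<close>
  also have "\<dots> = (\<Sum>\<tau> \<in> witness_trees \<B> t B. measure_pmf.expectation (Omega n p) (potential n p \<tau>))"
    by (simp add: predicted_def resample_count_def integrable_measure_pmf_finite[OF finite_Omega])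
  also have "\<dots> \<le> (\<Sum>\<tau> \<in> witness_trees \<B> t B. tree_weight (PO n p) \<tau>)"
    by (intro sum_mono expectation_potential_le)
  finally show ?thesis .
qed

section \<open>Expected number of steps and termination\<close>

lemma expectation_resample_count_Suc:
  "measure_pmf.expectation (hist (Suc t)) (\<lambda>h. real (resample_count sel B h)) =
    measure_pmf.expectation (hist t) (\<lambda>h. real (resample_count sel B h)) +
    measure_pmf.prob (hist t) {h. some_true \<B> (last h) \<and> sel h = B}"
proof -
  have "measure_pmf.expectation (step h) (\<lambda>h. real (resample_count sel B h)) =
      real (resample_count sel B h) + indicator {h. some_true \<B> (last h) \<and> sel h = B} h"
    if "h \<in> set_pmf (hist t)" for h
    using reachable_hist[OF that] by (auto simp: mt_step_def resample_count_append reachable_def)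
  then have "measure_pmf.expectation (hist (Suc t)) (\<lambda>h. real (resample_count sel B h)) =
      measure_pmf.expectation (hist t)
        (\<lambda>h. real (resample_count sel B h) + indicator {h. some_true \<B> (last h) \<and> sel h = B} h)"
    unfolding expectation_hist_Suc by (intro integral_cong_AE) (auto simp: AE_measure_pmf_iff)
  also have "\<dots> = measure_pmf.expectation (hist t) (\<lambda>h. real (resample_count sel B h)) +
      measure_pmf.prob (hist t) {h. some_true \<B> (last h) \<and> sel h = B}"
    by (simp add: integrable_measure_pmf_finite[OF finite_hist[of t]])
  finally show ?thesis .
qed

text \<open>Every step made before termination resamples exactly one event of \<B>, so both sides
  are the expected number of such steps among the first \<open>t\<close>.\<close>

lemma sum_expectation_resample_count:
  "(\<Sum>B \<in> \<B>. measure_pmf.expectation (hist t) (\<lambda>h. real (resample_count sel B h))) =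
    (\<Sum>s<t. measure_pmf.prob (hist s) {h. some_true \<B> (last h)})"
proof (induction t)
  case 0
  show ?case by (simp add: resample_count_def)
next
  case (Suc t)
  have "(\<Sum>B \<in> \<B>. measure_pmf.prob (hist t) {h. some_true \<B> (last h) \<and> sel h = B}) =
      measure_pmf.prob (hist t) (\<Union>B \<in> \<B>. {h. some_true \<B> (last h) \<and> sel h = B})"
    using finite_B
    by (intro measure_pmf.finite_measure_finite_Union[symmetric]) (auto simp: disjoint_family_on_def)
  also have "\<dots> = measure_pmf.prob (hist t) {h. some_true \<B> (last h)}"
    using sel_true(1) reachable_hist
    by (intro measure_pmf.finite_measure_eq_AE) (auto simp: AE_measure_pmf_iff)
  finally show ?case
    using Suc.IH by (simp add: expectation_resample_count_Suc sum.distrib del: mt_hist.simps)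
qed

text \<open>Bounded counts bound the partial sums of the probabilities of still running, so these
  probabilities are summable and tend to 0.\<close>

lemma terminates_if_bounded:
  assumes "\<And>B t. B \<in> \<B> \<Longrightarrow>
    measure_pmf.expectation (hist t) (\<lambda>h. real (resample_count sel B h)) \<le> \<mu> B"
  shows "(\<lambda>t. measure_pmf.prob (hist t) {h. \<not> some_true \<B> (last h)}) \<longlonglongrightarrow> 1"
proof -
  let ?q = "\<lambda>t. measure_pmf.prob (hist t) {h. some_true \<B> (last h)}"
  have "(\<Sum>s<t. ?q s) \<le> (\<Sum>B \<in> \<B>. \<mu> B)" for t
    unfolding sum_expectation_resample_count[symmetric] by (intro sum_mono assms)
  then have "summable ?q"
    by (intro bounded_imp_summable[of _ "\<Sum>B \<in> \<B>. \<mu> B"]) (auto simp: lessThan_Suc_atMost[symmetric] simp del: sum.lessThan_Suc)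
  then have "?q \<longlonglongrightarrow> 0" by (rule summable_LIMSEQ_zero)
  then have "(\<lambda>t. 1 - ?q t) \<longlonglongrightarrow> 1 - 0" by (intro tendsto_intros)
  moreover have "measure_pmf.prob (hist t) {h. \<not> some_true \<B> (last h)} = 1 - ?q t" for t
    using measure_pmf.prob_compl[of "{h. some_true \<B> (last h)}" "hist t"]
    by (simp add: Compl_eq_Diff_UNIV[symmetric] Collect_neg_eq)
  ultimately show ?thesis by simp
qed

end

text \<open>A history whose last state makes no event true no longer changes, so the limit is the
  probability of termination. Counts only grow with \<open>t\<close>, so by monotone convergence a
  bound for every \<open>t\<close> bounds the expected total count.\<close>

theorem theorem1p1:
  fixes n :: nat
    and p :: "nat \<Rightarrow> 'v pmf"
    and \<B> :: "'v bev set"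
    and \<mu> :: "'v bev \<Rightarrow> real"
    and sel :: "'v asg list \<Rightarrow> 'v bev"
  assumes finite_vals: "\<forall>i < n. finite (set_pmf (p i))"
    and finite_B: "finite \<B>"
    and atomic: "\<forall>B \<in> \<B>. finite B \<and> inj_on fst B \<and> fst ` B \<subseteq> {..<n}"
    and mu_nonneg: "\<forall>B \<in> \<B>. \<mu> B \<ge> 0"
    and mu_cond: "\<forall>B \<in> \<B>. \<mu> B \<ge> PO n p B * (\<Sum>Y \<in> {Y. Y \<subseteq> \<B> \<and> orderable Y B}. \<Prod>B' \<in> Y. \<mu> B')"
    and rule: "valid_rule \<B> sel"
  shows "((\<lambda>t. measure_pmf.prob (mt_hist \<B> n p sel t) {h. \<not> some_true \<B> (last h)}) \<longlonglongrightarrow> 1)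
       \<and> (\<forall>B \<in> \<B>. \<forall>t. measure_pmf.expectation (mt_hist \<B> n p sel t) (\<lambda>h. real (resample_count sel B h)) \<le> \<mu> B)"
proof -
  interpret moser_tardos n p \<B> sel
    by unfold_locales (use finite_vals finite_B atomic rule in auto)
  have bound: "measure_pmf.expectation (hist t) (\<lambda>h. real (resample_count sel B h)) \<le> \<mu> B"
    if "B \<in> \<B>" for B t
  proof -
    have "(\<Sum>\<tau> \<in> witness_trees \<B> t B. tree_weight (PO n p) \<tau>) \<le> \<mu> B"
      by (rule sum_tree_weight_le[OF finite_B PO_nonneg _ _ that]) (use mu_nonneg mu_cond in auto)
    then show ?thesis using expectation_resample_count_le[OF that, of t] by linarith
  qed
  then show ?thesis using terminates_if_bounded by blast
qed

end
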